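(* Let $\gamma>0$, let $m,n\in\mathbb{N}$, and let $T$ be the rank-one operator acting on $\mathcal{H}_\gamma(\mathbb{D})$ given by $T(f)=\langle f,z^m\rangle z^n$ for $f\in\mathcal{H}_\gamma(\mathbb{D})$. Then the Berezin range of $T$ is given by $$\mathrm{Ber}(T)=\begin{cases}\mathbb{D}_{R}, & \text{when } m\neq n,\\[4pt] \left[0,\ \dfrac{\gamma^\gamma n^n}{(n+\gamma)^{n+\gamma}}\right], & \text{when } m=n,\end{cases}\qquad\text{where } R=\left(\frac{2\gamma}{m+n+2\gamma}\right)^{\gamma}\left(\frac{m+n}{m+n+2\gamma}\right)^{\frac{m+n}{2}},$$ and in either case $\mathrm{Ber}(T)$ is convex in the complex plane $\mathbb{C}$.
   Context: $\mathbb{N}$ denotes the positive integers, $\mathbb{D}$ is the open unit disc in $\mathbb{C}$, and for $R>0$, $\mathbb{D}_R=\{w\in\mathbb{C}:|w|<R\}$ is the open disc of radius $R$ centered at the origin. For $\gamma>0$, $\mathcal{H}_\gamma(\mathbb{D})$ is the reproducing kernel Hilbert space of holomorphic functions on $\mathbb{D}$ with reproducing kernel $k_\lambda(z)=(1-\overline{\lambda}z)^{-\gamma}$ for $\lambda,z\in\mathbb{D}$ (principal branch), so $\langle f,k_\lambda\rangle=f(\lambda)$ and $\|k_\lambda\|^2=(1-|\lambda|^2)^{-\gamma}$. Put $\widehat{k}_\lambda=k_\lambda/\|k_\lambda\|$. For a bounded linear operator $T$ on $\mathcal{H}_\gamma(\mathbb{D})$, the Berezin transform is $\widetilde{T}(\lambda)=\langle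 T\widehat{k}_\lambda,\widehat{k}_\lambda\rangle$ for $\lambda\in\mathbb{D}$, and the Berezin range is $\mathrm{Ber}(T)=\{\widetilde{T}(\lambda):\lambda\in\mathbb{D}\}\subseteq\mathbb{C}$. Here $z^m$ denotes the function $z\mapsto z^m$.
   Formalization: For m ≠ n the Berezin range is stated as the closed disc |w| ≤ R instead of the open disc D_R, because the value R of the modulus is attained at |λ|² = (m+n)/(m+n+2γ) < 1, so the open-disc claim is false. *)

theory Defs
  imports "HOL-Analysis.Analysis"
begin

(* A function on X is represented by its extension by 0 to the whole type, so that
   equality in H is equality on X and H is closed under pointwise operations.
   The inner product ip is constrained only on H; it is linear in its first argument. *)

definition ip_norm :: "(('a \<Rightarrow> complex) \<Rightarrow> ('a \<Rightarrow> complex) \<Rightarrow> complex) \<Rightarrow> ('a \<Rightarrow> complex) \<Rightarrow> real"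
  where "ip_norm ip f = sqrt (Re (ip f f))"

locale function_hilbert_space =
  fixes X :: "'a set"
    and H :: "('a \<Rightarrow> complex) set"
    and ip :: "('a \<Rightarrow> complex) \<Rightarrow> ('a \<Rightarrow> complex) \<Rightarrow> complex"
  assumes zero_outside: "\<lbrakk>f \<in> H; x \<notin> X\<rbrakk> \<Longrightarrow> f x = 0"
    and zero_mem: "(\<lambda>x. 0) \<in> H"
    and add_mem: "\<lbrakk>f \<in> H; g \<in> H\<rbrakk> \<Longrightarrow> (\<lambda>x. f x + g x) \<in> H"
    and scale_mem: "f \<in> H \<Longrightarrow> (\<lambda>x. c * f x) \<in> H"
    and ip_add_left: "\<lbrakk>f \<in> H; g \<in> H; h \<in> H\<rbrakk> \<Longrightarrow> ip (\<lambda>x. f x + g x) h = ip f h + ip g h"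
    and ip_scale_left: "\<lbrakk>f \<in> H; h \<in> H\<rbrakk> \<Longrightarrow> ip (\<lambda>x. c * f x) h = c * ip f h"
    and ip_cnj: "\<lbrakk>f \<in> H; g \<in> H\<rbrakk> \<Longrightarrow> ip g f = cnj (ip f g)"
    and ip_nonneg: "f \<in> H \<Longrightarrow> 0 \<le> Re (ip f f)"
    and ip_definite: "\<lbrakk>f \<in> H; ip f f = 0\<rbrakk> \<Longrightarrow> f = (\<lambda>x. 0)"
    and complete:
      "\<lbrakk>\<And>i. F i \<in> H;
        \<forall>e>0. \<exists>N. \<forall>i\<ge>N. \<forall>j\<ge>N. ip_norm ip (\<lambda>x. F i x - F j x) < e\<rbrakk>
       \<Longrightarrow> \<exists>f\<in>H. (\<lambda>i::nat. ip_norm ip (\<lambda>x. F i x - f x)) \<longlonglongrightarrow> 0"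

(* K l is the kernel function at l, that is, K l x = k_l(x). *)
locale rkhs = function_hilbert_space X H ip
  for X :: "'a set" and H ip +
  fixes K :: "'a \<Rightarrow> 'a \<Rightarrow> complex"
  assumes kernel_mem: "l \<in> X \<Longrightarrow> K l \<in> H"
    and reproducing: "\<lbrakk>f \<in> H; l \<in> X\<rbrakk> \<Longrightarrow> ip f (K l) = f l"

definition normalized_kernel ::
    "(('a \<Rightarrow> complex) \<Rightarrow> ('a \<Rightarrow> complex) \<Rightarrow> complex) \<Rightarrow> ('a \<Rightarrow> 'a \<Rightarrow> complex) \<Rightarrow> 'a \<Rightarrow> 'a \<Rightarrow> complex"
  where "normalized_kernel ip K l = (\<lambda>x. K l x / of_real (ip_norm ip (K l)))"

definition berezin_transform ::
    "(('a \<Rightarrow> complex) \<Rightarrow> ('a \<Rightarrow> complex) \<Rightarrow> complex) \<Rightarrow> ('a \<Rightarrow> 'a \<Rightarrow> complex) \<Rightarrow>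
     (('a \<Rightarrow> complex) \<Rightarrow> ('a \<Rightarrow> complex)) \<Rightarrow> 'a \<Rightarrow> complex"
  where "berezin_transform ip K T l = ip (T (normalized_kernel ip K l)) (normalized_kernel ip K l)"

definition berezin_range ::
    "'a set \<Rightarrow> (('a \<Rightarrow> complex) \<Rightarrow> ('a \<Rightarrow> complex) \<Rightarrow> complex) \<Rightarrow> ('a \<Rightarrow> 'a \<Rightarrow> complex) \<Rightarrow>
     (('a \<Rightarrow> complex) \<Rightarrow> ('a \<Rightarrow> complex)) \<Rightarrow> complex set"
  where "berezin_range X ip K T = berezin_transform ip K T ` X"

abbreviation unit_disc :: "complex set"
  where "unit_disc \<equiv> ball 0 1"

(* Complex powr is the principal branch; 1 - cnj l * z has positive real part on the disc. *)
definition disc_kernel :: "real \<Rightarrow> complex \<Rightarrow> complex \<Rightarrow> complex"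
  where "disc_kernel \<gamma> l =
    (\<lambda>z. if z \<in> unit_disc then (1 - cnj l * z) powr (- complex_of_real \<gamma>) else 0)"

definition disc_monomial :: "nat \<Rightarrow> complex \<Rightarrow> complex"
  where "disc_monomial m = (\<lambda>z. if z \<in> unit_disc then z ^ m else 0)"

(* The space is determined by its kernel up to the irrelevant values of ip off H. *)
locale weighted_disc_space = rkhs unit_disc H ip "disc_kernel \<gamma>"
  for \<gamma> :: real and H ip +
  assumes holomorphic: "f \<in> H \<Longrightarrow> f holomorphic_on unit_disc"

end

theory Submission
  imports Defs
begin

text \<open>
  Since the space is only given through its kernel, the point is that it contains the monomials.
  Averaging \<open>\<omega> ^ (k * m)\<close> times the kernel at \<open>\<omega> ^ k / 2\<close> over the \<open>N\<close>-th roots of unity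
  \<open>\<omega> ^ k\<close> kills all Taylor coefficients of index below \<open>N\<close> except the \<open>m\<close>-th one. The
  reproducing property shows that these averages are Cauchy, so a nonzero multiple of \<open>z ^ m\<close>
  is their limit. The Berezin transform is then \<open>l ^ n * cnj l ^ m * (1 - \<bar>l\<bar>\<^sup>2) powr \<gamma>\<close>;
  its modulus takes exactly the values between 0 and its maximum, attained at
  \<open>\<bar>l\<bar>\<^sup>2 = (m + n) / (m + n + 2 * \<gamma>)\<close>, and for \<open>m \<noteq> n\<close> its argument is arbitrary.
\<close>

section \<open>Sesquilinear algebra, the Cauchy-Schwarz inequality and completeness\<close>

context function_hilbert_space
begin

lemma ip_add_right:
  assumes "f \<in> H" "g \<in> H" "h \<in> H"
  shows "ip h (\<lambda>x. f x + g x) = ip h f + ip h g"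
proof -
  have "ip h (\<lambda>x. f x + g x) = cnj (ip (\<lambda>x. f x + g x) h)"
    using assms by (intro ip_cnj add_mem)
  also have "\<dots> = cnj (ip f h) + cnj (ip g h)"
    using assms by (simp add: ip_add_left)
  finally show ?thesis
    using assms ip_cnj[of f h] ip_cnj[of g h] by simp
qed

lemma ip_scale_right:
  assumes "f \<in> H" "h \<in> H"
  shows "ip h (\<lambda>x. c * f x) = cnj c * ip h f"
proof -
  have "ip h (\<lambda>x. c * f x) = cnj (ip (\<lambda>x. c * f x) h)"
    using assms by (intro ip_cnj scale_mem)
  also have "\<dots> = cnj c * cnj (ip f h)"
    using assms by (simp add: ip_scale_left)
  finally show ?thesis
    using assms ip_cnj[of f h] by simp
qed

lemma ip_self_real:
  assumes "f \<in> H"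
  shows "ip f f = of_real (Re (ip f f))"
proof -
  have "Im (ip f f) = Im (cnj (ip f f))"
    by (rule arg_cong[OF ip_cnj[OF assms assms]])
  then have "Im (ip f f) = 0" unfolding cnj.simps by linarith
  then show ?thesis by (simp add: complex_eq_iff)
qed

lemma ip_zero_right: "h \<in> H \<Longrightarrow> ip h (\<lambda>x. 0) = 0"
  using ip_scale_right[of "\<lambda>x. 0" h 0] zero_mem by simp

lemma diff_mem: "f \<in> H \<Longrightarrow> g \<in> H \<Longrightarrow> (\<lambda>x. f x - g x) \<in> H"
  using add_mem[of f "\<lambda>x. (- 1) * g x"] scale_mem[of g "- 1"] by simp

lemma ip_diff_left:
  assumes "f \<in> H" "g \<in> H" "h \<in> H"
  shows "ip (\<lambda>x. f x - g x) h = ip f h - ip g h"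
  using assms ip_add_left[of f "\<lambda>x. (- 1) * g x" h] scale_mem[of g "- 1"]
    ip_scale_left[of g h "- 1"] by simp

lemma ip_diff_right:
  assumes "f \<in> H" "g \<in> H" "h \<in> H"
  shows "ip h (\<lambda>x. f x - g x) = ip h f - ip h g"
  using assms ip_add_right[of f "\<lambda>x. (- 1) * g x" h] scale_mem[of g "- 1"]
    ip_scale_right[of g h "- 1"] by simp

lemma lincomb_mem:
  "finite A \<Longrightarrow> (\<And>k. k \<in> A \<Longrightarrow> F k \<in> H) \<Longrightarrow> (\<lambda>x. \<Sum>k\<in>A. c k * F k x) \<in> H"
proof (induction A rule: finite_induct)
  case empty
  then show ?case by (simp add: zero_mem)
next
  case (insert k A)
  then have "(\<lambda>x. c k * F k x + (\<Sum>k\<in>A. c k * F k x)) \<in> H"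
    by (intro add_mem[OF scale_mem]) auto
  then show ?case using insert by simp
qed

lemma ip_lincomb_right:
  assumes "finite A" "\<And>k. k \<in> A \<Longrightarrow> F k \<in> H" "h \<in> H"
  shows "ip h (\<lambda>x. \<Sum>k\<in>A. c k * F k x) = (\<Sum>k\<in>A. cnj (c k) * ip h (F k))"
  using assms
proof (induction A rule: finite_induct)
  case empty
  then show ?case by (simp add: ip_zero_right)
next
  case (insert k A)
  have mem: "(\<lambda>x. c k * F k x) \<in> H" "(\<lambda>x. \<Sum>k\<in>A. c k * F k x) \<in> H"
    using insert.prems insert.hyps by (simp_all only: scale_mem lincomb_mem insert_iff simp_thms)
  have "ip h (\<lambda>x. c k * F k x + (\<Sum>k\<in>A. c k * F k x))
      = cnj (c k) * ip h (F k) + (\<Sum>k\<in>A. cnj (c k) * ip h (F k))"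
    using insert.prems insert.IH
    by (simp only: ip_add_right[OF mem] ip_scale_right insert_iff simp_thms)
  then show ?case using insert.hyps by simp
qed

text \<open>The residual of \<open>f\<close> after projection onto the line through \<open>g\<close>
  has nonnegative squared norm, which is the inequality after multiplication by
  \<open>ip g g\<close>.\<close>

lemma Cauchy_Schwarz:
  assumes f: "f \<in> H" and g: "g \<in> H"
  shows "cmod (ip f g) \<le> ip_norm ip f * ip_norm ip g"
proof (cases "ip g g = 0")
  case True
  then have "g = (\<lambda>x. 0)" using g ip_definite by blast
  then show ?thesis using ip_zero_right[OF f] ip_zero_right[OF zero_mem] by (simp add: ip_norm_def)
next
  case False
  define a b c where "a = Re (ip f f)" and "b = ip f g" and "c = Re (ip g g)"
  have fg: "ip f f = of_real a" "ip g g = of_real c" "ip f g = b" "ip g f = cnj b"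
    unfolding a_def b_def c_def
    by (rule ip_self_real[OF f] ip_self_real[OF g] refl ip_cnj[OF f g])+
  have "c \<noteq> 0" using False fg(2) by auto
  moreover have "c \<ge> 0" unfolding c_def by (rule ip_nonneg[OF g])
  ultimately have c: "c > 0" by simp
  \<comment> \<open>The coefficient of the orthogonal projection of \<open>f\<close> onto
    \<open>g\<close>.\<close>
  define t where "t = b / of_real c"
  have tg: "(\<lambda>x. t * g x) \<in> H" using g by (rule scale_mem)
  have "ip (\<lambda>x. f x - t * g x) (\<lambda>x. f x - t * g x)
      = of_real a - cnj t * b - t * (cnj b - cnj t * of_real c)"
    using f g tg by (simp add: ip_diff_left ip_diff_right ip_scale_left ip_scale_right diff_mem fg
        algebra_simps)
  also have "\<dots> = of_real (a - (cmod b)\<^sup>2 / c)"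
    using c complex_norm_square[of b] by (simp add: t_def mult.commute)
  finally have "0 \<le> a - (cmod b)\<^sup>2 / c"
    using ip_nonneg[OF diff_mem[OF f tg]] by simp
  then have "(cmod b)\<^sup>2 \<le> a * c" using c by (simp add: field_simps)
  then have "cmod b \<le> sqrt (a * c)" by (rule real_le_rsqrt)
  then show ?thesis by (simp add: ip_norm_def a_def b_def c_def real_sqrt_mult)
qed

text \<open>Expanding the squared norm of \<open>F i - F j\<close> gives four inner products with
  signs +, -, -, +, so \<open>c\<close> cancels and at most \<open>2 * t i + 2 * t j\<close> is
  left. The bound \<open>t i\<close> has to be uniform in \<open>j\<close> for this.\<close>

lemma Cauchy_if_ip_converges:
  assumes F: "\<And>i. F i \<in> H"
    and ip_F: "\<And>i j. cmod (ip (F i) (F j) - c) \<le> t i" and t: "t \<longlonglongrightarrow> 0"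
  shows "\<exists>f\<in>H. (\<lambda>i. ip_norm ip (\<lambda>x. F i x - f x)) \<longlonglongrightarrow> 0"
proof (rule complete[OF F], intro allI impI)
  fix e :: real assume e: "e > 0"
  have "\<forall>\<^sub>F i in sequentially. t i < e\<^sup>2 / 4"
    by (rule order_tendstoD(2)[OF t]) (use e in simp)
  then obtain N where N: "\<And>i. i \<ge> N \<Longrightarrow> t i < e\<^sup>2 / 4"
    by (auto simp: eventually_sequentially)
  have "ip_norm ip (\<lambda>x. F i x - F j x) < e" if ij: "i \<ge> N" "j \<ge> N" for i j
  proof -
    have "ip (\<lambda>x. F i x - F j x) (\<lambda>x. F i x - F j x)
        = (ip (F i) (F i) - c) - (ip (F i) (F j) - c) - (ip (F j) (F i) - c) + (ip (F j) (F j) - c)"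
      using F by (simp add: ip_diff_left ip_diff_right diff_mem)
    also have "cmod \<dots> \<le> t i + t i + t j + t j"
      by (rule norm_triangle_mono norm_triangle_le_diff[OF add_mono] ip_F)+
    also have "\<dots> < e\<^sup>2" using N[OF ij(1)] N[OF ij(2)] by simp
    finally have "Re (ip (\<lambda>x. F i x - F j x) (\<lambda>x. F i x - F j x)) < e\<^sup>2"
      by (rule order_le_less_trans[OF complex_Re_le_cmod])
    then show ?thesis
      unfolding ip_norm_def using e by (simp add: real_less_lsqrt)
  qed
  then show "\<exists>N. \<forall>i\<ge>N. \<forall>j\<ge>N. ip_norm ip (\<lambda>x. F i x - F j x) < e"
    by (intro exI[of _ N] allI impI)
qed

end

text \<open>Evaluation at \<open>l\<close> is the inner product with \<open>K l\<close>, hence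
  continuous by Cauchy-Schwarz.\<close>

lemma (in rkhs) norm_convergence_imp_pointwise:
  assumes F: "\<And>i. F i \<in> H" and f: "f \<in> H" and l: "l \<in> X"
    and lim: "(\<lambda>i. ip_norm ip (\<lambda>x. F i x - f x)) \<longlonglongrightarrow> 0"
  shows "(\<lambda>i. F i l) \<longlonglongrightarrow> f l"
proof (rule Lim_transform2[OF tendsto_const])
  have "norm (f l - F i l) \<le> ip_norm ip (\<lambda>x. F i x - f x) * ip_norm ip (K l)" for i
    using Cauchy_Schwarz[OF diff_mem[OF F[of i] f] kernel_mem[OF l]]
      reproducing[OF diff_mem[OF F[of i] f] l] by (simp add: norm_minus_commute)
  then show "(\<lambda>i. f l - F i l) \<longlonglongrightarrow> 0"
    using tendsto_mult_left_zero[OF lim] by (rule Lim_null_comparison[OF always_eventually, OF allI])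
qed

section \<open>Taylor coefficients of the kernel and averages over roots of unity\<close>

lemma root_of_unity_power_sum:
  fixes N m j :: nat
  assumes "m < N" "j < N"
  defines "w \<equiv> cis (2 * pi / real N)"
  shows "(\<Sum>k<N. w ^ (k * m) * cnj w ^ (k * j)) = (if j = m then of_nat N else 0)"
proof -
  \<comment> \<open>Every summand is a power of the \<open>N\<close>-th root of unity
    \<open>q\<close>, so the sum is geometric and vanishes unless \<open>q = 1\<close>.\<close>
  define q where "q = w ^ m * cnj w ^ j"
  have q_eq: "q = cis (2 * pi * (real m - real j) / real N)"
    unfolding q_def w_def cis_cnj
    by (simp add: Complex.DeMoivre cis_mult algebra_simps diff_divide_distrib)
  have term_eq: "w ^ (k * m) * cnj w ^ (k * j) = q ^ k" for k
    by (simp add: q_def power_mult_distrib power_mult[symmetric] mult.commute)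
  show ?thesis
  proof (cases "j = m")
    case True
    then show ?thesis unfolding term_eq q_eq by simp
  next
    case False
    have "q \<noteq> 1"
    proof
      assume "q = 1"
      then have "cos (2 * pi * (real m - real j) / real N) = 1"
        by (simp add: q_eq complex_eq_iff)
      then obtain i :: int where "2 * pi * (real m - real j) / real N = of_int i * (2 * pi)"
        by (auto simp: cos_one_2pi_int)
      then have "2 * pi * (real m - real j) = 2 * pi * (of_int i * real N)"
        using assms(1) by (simp add: field_simps)
      then have "real m - real j = of_int i * real N" by simp
      then have i: "int m - int j = i * int N"
        using of_int_eq_iff[of "int m - int j" "i * int N", where 'a = real] by simp
      \<comment> \<open>Both indices lie below \<open>N\<close>, so \<open>N\<close> cannot divide
        their nonzero difference.\<close>
      then have "int N dvd int m - int j" by simp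
      moreover have "int m - int j \<noteq> 0" using False by simp
      ultimately have "\<bar>int N\<bar> \<le> \<bar>int m - int j\<bar>" by (intro dvd_imp_le_int)
      then show False using assms(1,2) by linarith
    qed
    moreover have "q ^ N = 1"
    proof -
      have "q ^ N = cis (2 * pi * of_int (int m - int j))"
        using assms by (simp add: q_eq Complex.DeMoivre)
      then show ?thesis by (simp only: cis_multiple_2pi Ints_of_int)
    qed
    ultimately show ?thesis
      unfolding term_eq using False by (simp add: sum_gp_strict)
  qed
qed

text \<open>No factor \<open>- \<gamma> - i\<close> of the falling factorial vanishes. This later
  allows dividing by the coefficient to recover \<open>z ^ m\<close> from the limit of the
  averages.\<close>

lemma gchoose_neg_nonzero:
  assumes "\<gamma> > (0::real)"
  shows "(- complex_of_real \<gamma>) gchoose m \<noteq> 0"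
proof -
  have "- complex_of_real \<gamma> - of_nat i \<noteq> 0" for i
  proof
    assume "- complex_of_real \<gamma> - of_nat i = 0"
    then have "- \<gamma> - real i = 0" by (auto simp: complex_eq_iff)
    then show False using assms by linarith
  qed
  then show ?thesis by (simp add: gbinomial_prod_rev)
qed

text \<open>The coefficient of \<open>x ^ j\<close> in the binomial series of
  \<open>(1 - x) powr (- \<gamma>)\<close>, that is, \<gamma> (\<gamma> + 1) ... (\<gamma> + j - 1)
  / j!.\<close>

definition kernel_coeff :: "real \<Rightarrow> nat \<Rightarrow> complex"
  where "kernel_coeff \<gamma> j = ((- complex_of_real \<gamma>) gchoose j) * (- 1) ^ j"

lemma kernel_series:
  assumes "cmod l < 1" "cmod z < 1"
  shows "(\<lambda>j. kernel_coeff \<gamma> j * (cnj l * z) ^ j) sums disc_kernel \<gamma> l z"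
proof -
  have "cmod (- (cnj l * z)) < 1"
    using assms mult_strict_mono[of "cmod l" 1 "cmod z" 1] by (simp add: norm_mult)
  from gen_binomial_complex[OF this, of "- complex_of_real \<gamma>"] show ?thesis
    using assms by (simp add: disc_kernel_def kernel_coeff_def power_minus[of "_ * _"] mult.assoc)
qed

lemma summable_norm_kernel_coeff:
  fixes r :: real
  assumes "0 \<le> r" "r < 1"
  shows "summable (\<lambda>j. cmod (kernel_coeff \<gamma> j) * r ^ j)"
proof -
  \<comment> \<open>An intermediate radius: convergence of the power series at \<open>s < 1\<close>
    gives absolute convergence at the smaller \<open>r\<close>.\<close>
  define s where "s = (1 + r) / 2"
  have s: "r < s" "s < 1" using assms by (auto simp: s_def)
  have "summable (\<lambda>j. ((- complex_of_real \<gamma>) gchoose j) * of_real s ^ j)"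
    using gen_binomial_complex[of "of_real s" "- complex_of_real \<gamma>"] s assms
    by (auto simp: sums_iff)
  then have "summable (\<lambda>j. norm (((- complex_of_real \<gamma>) gchoose j) * of_real r ^ j))"
    by (rule powser_insidea) (use s assms in auto)
  then show ?thesis using assms by (simp add: kernel_coeff_def norm_mult norm_power)
qed

text \<open>A discrete Fourier coefficient of the kernel as a function of \<open>cnj l\<close>,
  sampled at \<open>N\<close> equally spaced points of the circle of radius 1/2. The radius keeps
  the samples inside the disc and makes the error uniform in \<open>z\<close>.\<close>

definition kernel_average :: "real \<Rightarrow> nat \<Rightarrow> nat \<Rightarrow> complex \<Rightarrow> complex"
  where "kernel_average \<gamma> m N =
    (let w = cis (2 * pi / real N)
     in (\<lambda>z. \<Sum>k<N. (w ^ (k * m) / of_nat N) * disc_kernel \<gamma> (w ^ k / 2) z))"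

definition kernel_tail :: "real \<Rightarrow> nat \<Rightarrow> real"
  where "kernel_tail \<gamma> N = (\<Sum>j. cmod (kernel_coeff \<gamma> (j + N)) * (1 / 2) ^ (j + N))"

lemma kernel_tail_tendsto_0: "kernel_tail \<gamma> \<longlonglongrightarrow> 0"
  unfolding kernel_tail_def
  using suminf_exist_split2[OF summable_norm_kernel_coeff[of "1/2" \<gamma>]] by simp

text \<open>Averaging multiplies the \<open>j\<close>-th Taylor term by a factor \<open>s j\<close>.
  Below \<open>N\<close> it is 1 for \<open>j = m\<close> and 0 otherwise; from \<open>N\<close> on,
  where indices may alias with \<open>m\<close>, only \<open>cmod (s j) \<le> 1\<close> is used, and
  the tail of the series absorbs these terms.\<close>

lemma kernel_average_approx:
  assumes z: "cmod z < 1" and mN: "m < N"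
  shows "cmod (kernel_average \<gamma> m N z - kernel_coeff \<gamma> m * (z / 2) ^ m) \<le> kernel_tail \<gamma> N"
proof -
  define w where "w = cis (2 * pi / real N)"
  define a where "a = kernel_coeff \<gamma>"
  define s where "s j = (\<Sum>k<N. w ^ (k * m) * cnj w ^ (k * j)) / of_nat N" for j
  have N: "N > 0" using mN by simp
  have s_lt: "s j = (if j = m then 1 else 0)" if "j < N" for j
    using root_of_unity_power_sum[OF mN that] N by (auto simp: s_def w_def)
  have w1: "cmod w = 1" by (simp add: w_def)
  have s_le: "cmod (s j) \<le> 1" for j
  proof -
    have "cmod (\<Sum>k<N. w ^ (k * m) * cnj w ^ (k * j)) \<le> (\<Sum>k<N. 1)"
      by (intro sum_norm_le) (simp add: norm_mult norm_power w1)
    then show ?thesis using N by (simp add: s_def norm_divide)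
  qed
  have "(\<lambda>j. \<Sum>k<N. (w ^ (k * m) / of_nat N) * (a j * (cnj (w ^ k / 2) * z) ^ j))
      sums kernel_average \<gamma> m N z"
    unfolding kernel_average_def w_def[symmetric] Let_def a_def
    by (intro sums_sum sums_mult kernel_series z) (simp add: norm_divide norm_power w1)
  moreover have "(\<Sum>k<N. (w ^ (k * m) / of_nat N) * (a j * (cnj (w ^ k / 2) * z) ^ j))
      = a j * (z / 2) ^ j * s j" for j
    unfolding s_def sum_divide_distrib sum_distrib_left
    by (intro sum.cong refl)
      (simp add: power_mult_distrib power_divide power_mult[symmetric] ac_simps)
  ultimately have sums: "(\<lambda>j. a j * (z / 2) ^ j * s j) sums kernel_average \<gamma> m N z"
    by simp
  have "(\<Sum>j<N. a j * (z / 2) ^ j * s j) = (\<Sum>j<N. if j = m then a m * (z / 2) ^ m else 0)"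
    by (intro sum.cong refl) (simp add: s_lt)
  also have "\<dots> = a m * (z / 2) ^ m" using mN by simp
  finally have "(\<lambda>j. a (j + N) * (z / 2) ^ (j + N) * s (j + N))
      sums (kernel_average \<gamma> m N z - a m * (z / 2) ^ m)"
    using sums_split_initial_segment[OF sums, of N] by simp
  moreover have "cmod (\<Sum>j. a (j + N) * (z / 2) ^ (j + N) * s (j + N)) \<le> kernel_tail \<gamma> N"
    unfolding kernel_tail_def
  proof (rule norm_suminf_le)
    show "summable (\<lambda>j. cmod (kernel_coeff \<gamma> (j + N)) * (1 / 2) ^ (j + N))"
      using summable_norm_kernel_coeff[of "1/2" \<gamma>] by (subst summable_iff_shift) auto
  next
    fix j
    have "cmod ((z / 2) ^ (j + N)) \<le> (1 / 2) ^ (j + N)"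
      unfolding norm_power using z by (intro power_mono) (auto simp: norm_divide)
    then have "cmod (a (j + N)) * cmod ((z / 2) ^ (j + N)) * cmod (s (j + N))
        \<le> cmod (a (j + N)) * (1 / 2) ^ (j + N) * 1"
      by (intro mult_mono s_le) auto
    then show "cmod (a (j + N) * (z / 2) ^ (j + N) * s (j + N))
        \<le> cmod (kernel_coeff \<gamma> (j + N)) * (1 / 2) ^ (j + N)"
      by (simp add: norm_mult a_def)
  qed
  ultimately show ?thesis by (simp add: sums_iff a_def)
qed

section \<open>Monomials in the space and the Berezin transform of the rank-one operator\<close>

context weighted_disc_space
begin

lemma kernel_average_mem: "kernel_average \<gamma> m N \<in> H"
  unfolding kernel_average_def Let_def
  by (intro lincomb_mem kernel_mem) (auto simp: norm_divide norm_power)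

text \<open>By the reproducing property, pairing with the second average samples the first one at
  the points \<open>w ^ k / 2\<close>. There it is close to a multiple of
  \<open>(z / 2) ^ m\<close>, for which the weighted sum is exact. The error does not depend on
  \<open>M\<close>, as the Cauchy criterion requires.\<close>

lemma ip_kernel_average:
  assumes "m < M" "m < N"
  shows "cmod (ip (kernel_average \<gamma> m N) (kernel_average \<gamma> m M) - kernel_coeff \<gamma> m / 4 ^ m)
    \<le> kernel_tail \<gamma> N"
proof -
  define w where "w = cis (2 * pi / real M)"
  define h where "h = kernel_average \<gamma> m N"
  define a where "a = kernel_coeff \<gamma> m"
  have M: "M > 0" using assms by simp
  have w1: "cmod w = 1" by (simp add: w_def)
  have in_disc: "w ^ k / 2 \<in> unit_disc" for k by (simp add: norm_divide norm_power w1)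
  have ip_eq: "ip h (kernel_average \<gamma> m M)
      = (\<Sum>k<M. cnj (w ^ (k * m) / of_nat M) * h (w ^ k / 2))"
    unfolding kernel_average_def[of _ _ M] w_def[symmetric] Let_def
    by (subst ip_lincomb_right)
      (simp_all add: h_def kernel_average_mem reproducing[OF kernel_average_mem in_disc]
        kernel_mem[OF in_disc])
  have unimodular: "cnj (w ^ (k * m)) * w ^ (k * m) = 1" for k
    using complex_norm_square[of "w ^ (k * m)"] by (simp add: norm_power w1 mult.commute)
  \<comment> \<open>One factor 1/2 comes from the approximant \<open>(z / 2) ^ m\<close>, the other
    from the sample point; the remaining phase cancels against the weight, so all summands are
    equal.\<close>
  have "(w ^ k / 4) ^ m = w ^ (k * m) / 4 ^ m" for k
    by (simp add: power_divide power_mult)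
  then have "cnj (w ^ (k * m) / of_nat M) * (a * (w ^ k / 2 / 2) ^ m) = a / 4 ^ m / of_nat M" for k
    using unimodular[of k] by (simp add: field_simps)
  then have "(\<Sum>k<M. cnj (w ^ (k * m) / of_nat M) * (a * (w ^ k / 2 / 2) ^ m)) = a / 4 ^ m"
    using M by simp
  then have "ip h (kernel_average \<gamma> m M) - a / 4 ^ m
      = (\<Sum>k<M. cnj (w ^ (k * m) / of_nat M) * (h (w ^ k / 2) - a * (w ^ k / 2 / 2) ^ m))"
    unfolding ip_eq right_diff_distrib sum_subtractf by simp
  also have "cmod \<dots> \<le> (\<Sum>k<M. kernel_tail \<gamma> N / real M)"
  proof (intro sum_norm_le)
    fix k
    have "cmod (h (w ^ k / 2) - a * (w ^ k / 2 / 2) ^ m) \<le> kernel_tail \<gamma> N"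
      unfolding h_def a_def using in_disc assms by (intro kernel_average_approx) auto
    then show "cmod (cnj (w ^ (k * m) / of_nat M) * (h (w ^ k / 2) - a * (w ^ k / 2 / 2) ^ m))
        \<le> kernel_tail \<gamma> N / real M"
      using M by (simp add: norm_mult norm_divide norm_power w1 divide_right_mono)
  qed
  also have "\<dots> = kernel_tail \<gamma> N" using M by simp
  finally show ?thesis by (simp add: h_def a_def)
qed

lemma disc_monomial_mem:
  assumes "\<gamma> > 0"
  shows "disc_monomial m \<in> H"
proof -
  \<comment> \<open>Starting at \<open>Suc m\<close> guarantees that the number of sample points
    always exceeds \<open>m\<close>.\<close>
  define F where "F i = kernel_average \<gamma> m (Suc m + i)" for i
  define t where "t i = kernel_tail \<gamma> (Suc m + i)" for i
  have F: "F i \<in> H" for i unfolding F_def by (rule kernel_average_mem)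
  have t: "t \<longlonglongrightarrow> 0"
    using LIMSEQ_ignore_initial_segment[OF kernel_tail_tendsto_0, of \<gamma> "Suc m"]
    unfolding t_def by (simp add: add.commute)
  have "cmod (ip (F i) (F j) - kernel_coeff \<gamma> m / 4 ^ m) \<le> t i" for i j
    unfolding F_def t_def by (rule ip_kernel_average) auto
  from Cauchy_if_ip_converges[OF F this t]
  obtain f where f: "f \<in> H" and lim: "(\<lambda>i. ip_norm ip (\<lambda>x. F i x - f x)) \<longlonglongrightarrow> 0"
    by blast
  \<comment> \<open>The factor of \<open>z ^ m\<close> in the pointwise limit of the averages. It is
    nonzero, so the limit in \<open>H\<close> can be rescaled to the monomial.\<close>
  define c where "c = kernel_coeff \<gamma> m / 2 ^ m"
  have c: "c \<noteq> 0" using gchoose_neg_nonzero[OF assms] by (simp add: c_def kernel_coeff_def)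
  have "f z = c * disc_monomial m z" for z
  proof (cases "z \<in> unit_disc")
    case True
    then have "cmod (F i z - c * z ^ m) \<le> t i" for i
      using kernel_average_approx[of z m "Suc m + i" \<gamma>]
      by (simp add: F_def t_def c_def power_divide)
    then have "(\<lambda>i. F i z - c * z ^ m) \<longlonglongrightarrow> 0"
      by (intro Lim_null_comparison[OF _ t] always_eventually allI)
    then have "(\<lambda>i. F i z) \<longlonglongrightarrow> c * z ^ m"
      using Lim_null by blast
    moreover have "(\<lambda>i. F i z) \<longlonglongrightarrow> f z"
      by (rule norm_convergence_imp_pointwise[OF F f True lim])
    ultimately show ?thesis
      using True LIMSEQ_unique by (auto simp: disc_monomial_def)
  next
    \<comment> \<open>Off the disc both functions vanish by convention, so they agree on the whole
      type.\<close>
    case False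
    then show ?thesis using zero_outside[OF f] by (simp add: disc_monomial_def)
  qed
  then have "disc_monomial m = (\<lambda>z. inverse c * f z)"
    using c by (simp add: fun_eq_iff)
  then show ?thesis using scale_mem[OF f] by metis
qed

text \<open>The reproducing property evaluates both pairings of the normalized kernel with the
  monomials. Each contributes one factor \<open>inverse N\<close>, and the squared kernel norm is
  the kernel on the diagonal.\<close>

lemma berezin_transform_rank_one:
  assumes "\<gamma> > 0" and l: "l \<in> unit_disc"
    and T: "\<And>f. f \<in> H \<Longrightarrow> T f = (\<lambda>z. ip f (disc_monomial m) * disc_monomial n z)"
  shows "berezin_transform ip (disc_kernel \<gamma>) T l
    = of_real ((1 - (cmod l)\<^sup>2) powr \<gamma>) * (cnj l ^ m * l ^ n)"
proof -
  define N where "N = ip_norm ip (disc_kernel \<gamma> l)"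
  define k where "k = normalized_kernel ip (disc_kernel \<gamma>) l"
  have l1: "(cmod l)\<^sup>2 < 1" using l by (simp add: power_less_one_iff)
  have K: "disc_kernel \<gamma> l \<in> H" using l by (rule kernel_mem)
  have mono: "disc_monomial j \<in> H" for j using assms(1) by (rule disc_monomial_mem)
  have k_eq: "k = (\<lambda>z. of_real (inverse N) * disc_kernel \<gamma> l z)"
    by (simp add: k_def normalized_kernel_def N_def fun_eq_iff field_simps)
  have k: "k \<in> H" unfolding k_eq using K by (rule scale_mem)
  have ip_k: "ip (disc_monomial j) k = of_real (inverse N) * l ^ j" for j
    unfolding k_eq using ip_scale_right[OF K mono] reproducing[OF mono l] l
    by (simp add: disc_monomial_def)
  have k_ip: "ip k (disc_monomial j) = of_real (inverse N) * cnj l ^ j" for j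
    using ip_cnj[OF mono k] by (simp add: ip_k)
  have "ip (disc_kernel \<gamma> l) (disc_kernel \<gamma> l) = (1 - cnj l * l) powr (- of_real \<gamma>)"
    using reproducing[OF K l] l by (simp add: disc_kernel_def)
  also have "1 - cnj l * l = of_real (1 - (cmod l)\<^sup>2)"
    by (simp only: of_real_diff of_real_1 complex_norm_square mult.commute)
  \<comment> \<open>The base is a positive real, where the principal branch agrees with the real
    power.\<close>
  also have "\<dots> powr (- of_real \<gamma>) = of_real ((1 - (cmod l)\<^sup>2) powr (- \<gamma>))"
    using l1 by (simp add: powr_of_real[symmetric])
  finally have "N\<^sup>2 = (1 - (cmod l)\<^sup>2) powr (- \<gamma>)"
    by (simp add: N_def ip_norm_def)
  then have N: "inverse N * inverse N = (1 - (cmod l)\<^sup>2) powr \<gamma>"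
    by (simp add: powr_minus power2_eq_square flip: inverse_mult_distrib)
  have "berezin_transform ip (disc_kernel \<gamma>) T l = ip k (disc_monomial m) * ip (disc_monomial n) k"
    unfolding berezin_transform_def k_def[symmetric] T[OF k] using mono k by (rule ip_scale_left)
  also have "\<dots> = of_real (inverse N * inverse N) * (cnj l ^ m * l ^ n)"
    by (simp add: ip_k k_ip)
  finally show ?thesis by (simp only: N)
qed

end

section \<open>Maximum and range of the modulus\<close>

lemma powr_product_le_max:
  fixes a b s :: real
  assumes "a > 0" "b > 0" "0 < s" "s < 1"
  shows "(1 - s) powr b * s powr a \<le> (b / (a + b)) powr b * (a / (a + b)) powr a"
proof -
  \<comment> \<open>\<open>s0\<close> is the maximiser and \<open>t0 = 1 - s0\<close>. The bound
    \<open>ln x \<le> x - 1\<close> is applied to the ratios to these values; with weights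
    \<open>a\<close> and \<open>b\<close> the linear right-hand sides add up to zero.\<close>
  define s0 t0 where "s0 = a / (a + b)" and "t0 = b / (a + b)"
  have pos: "s0 > 0" "t0 > 0" using assms by (auto simp: s0_def t0_def)
  have "ln (s / s0) \<le> s / s0 - 1" "ln ((1 - s) / t0) \<le> (1 - s) / t0 - 1"
    using pos assms by (auto intro!: ln_le_minus_one)
  then have "a * ln (s / s0) + b * ln ((1 - s) / t0) \<le> a * (s / s0 - 1) + b * ((1 - s) / t0 - 1)"
    using assms by (intro add_mono mult_left_mono) auto
  also have "\<dots> = 0" using assms by (simp add: s0_def t0_def field_simps)
  finally have "b * ln (1 - s) + a * ln s \<le> b * ln t0 + a * ln s0"
    using assms pos by (simp add: ln_div algebra_simps)
  then have "exp (b * ln (1 - s) + a * ln s) \<le> exp (b * ln t0 + a * ln s0)" by simp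
  then show ?thesis
    using assms pos by (simp add: powr_def exp_add s0_def[symmetric] t0_def[symmetric])
qed

text \<open>The substitution \<open>s = r\<^sup>2\<close> with exponents \<open>p / 2\<close> and
  \<open>\<gamma>\<close> gives the upper bound. It is attained at a radius below 1, and the value
  at 0 is 0 since \<open>p > 0\<close>, so the intermediate value theorem supplies everything
  between.\<close>

lemma modulus_profile_image:
  fixes \<gamma> :: real and p :: nat
  assumes "\<gamma> > 0" "p > 0"
  shows "(\<lambda>r. (1 - r\<^sup>2) powr \<gamma> * r ^ p) ` {0..<1}
    = {0 .. (2 * \<gamma> / (p + 2 * \<gamma>)) powr \<gamma> * (p / (p + 2 * \<gamma>)) powr (p / 2)}"
    (is "?f ` _ = {0..?R}")
proof -
  have frac: "\<gamma> / (real p / 2 + \<gamma>) = 2 * \<gamma> / (p + 2 * \<gamma>)"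
      "(real p / 2) / (real p / 2 + \<gamma>) = p / (p + 2 * \<gamma>)"
    using assms by (auto simp: field_simps)
  have sq: "(r\<^sup>2) powr (real p / 2) = r ^ p" if "r > 0" for r :: real
  proof -
    have "r\<^sup>2 = r powr 2" using that by (simp add: powr_numeral)
    then show ?thesis using that by (simp only: powr_powr) (simp add: powr_realpow)
  qed
  have "?f r \<in> {0..?R}" if r: "r \<in> {0..<1}" for r
  proof (cases "r = 0")
    case True
    then show ?thesis using assms by (simp add: zero_power)
  next
    case False
    then have "0 < r\<^sup>2" "r\<^sup>2 < 1" "r > 0" using r by (auto simp: power_less_one_iff)
    then show ?thesis
      using powr_product_le_max[of "real p / 2" \<gamma> "r\<^sup>2"] assms r unfolding frac by (simp add: sq)
  qed
  moreover have "y \<in> ?f ` {0..<1}" if y: "y \<in> {0..?R}" for y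
  proof -
    \<comment> \<open>The square of \<open>r0\<close> is the maximiser \<open>a / (a + b)\<close>
      for \<open>a = p / 2\<close> and \<open>b = \<gamma>\<close>.\<close>
    define r0 where "r0 = sqrt (p / (p + 2 * \<gamma>))"
    have r0: "0 < r0" "r0 < 1" using assms by (auto simp: r0_def)
    have r0_sq: "r0\<^sup>2 = p / (p + 2 * \<gamma>)" using assms by (simp add: r0_def)
    have "1 - r0\<^sup>2 = 2 * \<gamma> / (p + 2 * \<gamma>)" unfolding r0_sq using assms by (simp add: field_simps)
    then have top: "?f r0 = ?R" using sq[OF r0(1)] unfolding r0_sq by simp
    have "continuous_on {0..r0} ?f"
    proof (intro continuous_intros ballI)
      fix x assume "x \<in> {0..r0}"
      then have "x\<^sup>2 < 1" using r0 by (simp add: power_less_one_iff)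
      then show "1 - x\<^sup>2 \<noteq> 0" by simp
    qed
    moreover have "?f 0 \<le> y" "y \<le> ?f r0" using y assms top by (auto simp: zero_power)
    ultimately obtain r where "0 \<le> r" "r \<le> r0" "?f r = y"
      using IVT'[of ?f 0 y r0] r0 by auto
    then show ?thesis using r0 by (intro image_eqI[of _ _ r]) auto
  qed
  ultimately show ?thesis by blast
qed

section \<open>Shape and convexity of the Berezin range\<close>

theorem theorem3p7:
  fixes \<gamma> R :: real
    and m n :: nat
    and H :: "(complex \<Rightarrow> complex) set"
    and ip :: "(complex \<Rightarrow> complex) \<Rightarrow> (complex \<Rightarrow> complex) \<Rightarrow> complex"
    and T :: "(complex \<Rightarrow> complex) \<Rightarrow> (complex \<Rightarrow> complex)"
  assumes "\<gamma> > 0" and "m \<ge> 1" and "n \<ge> 1"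
    and "weighted_disc_space \<gamma> H ip"
    and "\<And>f. f \<in> H \<Longrightarrow> T f = (\<lambda>z. ip f (disc_monomial m) * disc_monomial n z)"
    and "R = (2 * \<gamma> / (real m + real n + 2 * \<gamma>)) powr \<gamma>
           * ((real m + real n) / (real m + real n + 2 * \<gamma>)) powr ((real m + real n) / 2)"
  shows "berezin_range unit_disc ip (disc_kernel \<gamma>) T =
           (if m \<noteq> n then cball 0 R
            else complex_of_real ` {0 .. \<gamma> powr \<gamma> * real n ^ n / (real n + \<gamma>) powr (real n + \<gamma>)})
         \<and> convex (berezin_range unit_disc ip (disc_kernel \<gamma>) T)"
proof -
  interpret weighted_disc_space \<gamma> H ip by fact
  define f where "f r = (1 - r\<^sup>2) powr \<gamma> * r ^ (m + n)" for r :: real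
  define \<Phi> where "\<Phi> l = complex_of_real ((1 - (cmod l)\<^sup>2) powr \<gamma>) * (cnj l ^ m * l ^ n)" for l
  have range: "berezin_range unit_disc ip (disc_kernel \<gamma>) T = \<Phi> ` unit_disc"
    unfolding berezin_range_def \<Phi>_def
    using berezin_transform_rank_one[OF assms(1) _ assms(5)] by (intro image_cong) auto
  have f_image: "f ` {0..<1} = {0..R}"
    unfolding f_def assms(6) using modulus_profile_image[of \<gamma> "m + n"] assms(1,2) by simp
  \<comment> \<open>On the circle of radius \<open>r\<close> the modulus is the constant
    \<open>f r\<close>, while the phase turns \<open>n - m\<close> times as fast as the argument of
    the point. For \<open>m = n\<close> only the modulus remains.\<close>
  have \<Phi>_polar: "\<Phi> (of_real r * cis t) = of_real (f r) * cis ((real n - real m) * t)"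
    if "r \<ge> 0" for r t
  proof -
    have "cnj (cis t) ^ m * cis t ^ n = cis ((real n - real m) * t)"
      unfolding cis_cnj by (simp add: Complex.DeMoivre cis_mult algebra_simps)
    then show ?thesis
      using that
      by (simp add: \<Phi>_def f_def norm_mult power_mult_distrib power_add mult.assoc mult.left_commute)
  qed
  have "\<Phi> ` unit_disc = (if m \<noteq> n then cball 0 R else of_real ` {0..R})"
  proof (cases "m = n")
    case True
    have "\<Phi> ` unit_disc = of_real ` f ` {0..<1}"
    proof (intro equalityI subsetI)
      fix w assume "w \<in> \<Phi> ` unit_disc"
      then obtain l where l: "l \<in> unit_disc" "w = \<Phi> l" by blast
      have "w = of_real (f (cmod l))"
        using \<Phi>_polar[of "cmod l" "Arg l"] l True rcis_cmod_Arg[of l] by (simp add: rcis_def)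
      then show "w \<in> of_real ` f ` {0..<1}" using l by auto
    next
      fix w :: complex assume "w \<in> of_real ` f ` {0..<1}"
      then obtain r where r: "r \<in> {0..<1}" "w = of_real (f r)" by blast
      then have "w = \<Phi> (of_real r)" using \<Phi>_polar[of r 0] by simp
      then show "w \<in> \<Phi> ` unit_disc" using r by auto
    qed
    then show ?thesis using True f_image by simp
  next
    case False
    have "\<Phi> ` unit_disc = cball 0 R"
    proof (intro equalityI subsetI)
      fix w assume "w \<in> \<Phi> ` unit_disc"
      then obtain l where l: "l \<in> unit_disc" "w = \<Phi> l" by blast
      have "w = of_real (f (cmod l)) * cis ((real n - real m) * Arg l)"
        using \<Phi>_polar[of "cmod l" "Arg l"] l rcis_cmod_Arg[of l] by (simp add: rcis_def)
      moreover have "f (cmod l) \<in> {0..R}" using l f_image by auto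
      ultimately show "w \<in> cball 0 R" by (simp add: norm_mult)
    next
      fix w :: complex assume "w \<in> cball 0 R"
      \<comment> \<open>Boundary points are covered too: \<open>f\<close> attains \<open>R\<close>
        at a radius below 1, which is why the disc is closed.\<close>
      then have "cmod w \<in> f ` {0..<1}" unfolding f_image by simp
      then obtain r where r: "r \<in> {0..<1}" "cmod w = f r" by blast
      \<comment> \<open>Since \<open>n - m\<close> is nonzero, dividing the argument of
        \<open>w\<close> by it gives a point whose image has the phase of \<open>w\<close>.\<close>
      have "w = \<Phi> (of_real r * cis (Arg w / (real n - real m)))"
        using \<Phi>_polar[of r "Arg w / (real n - real m)"] r False rcis_cmod_Arg[of w]
        by (simp add: rcis_def)
      then show "w \<in> \<Phi> ` unit_disc" using r by (auto simp: norm_mult)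
    qed
    then show ?thesis using False by simp
  qed
  \<comment> \<open>For equal exponents the factors 2 cancel, and the two powers of
    \<open>n + \<gamma>\<close> in the denominators combine.\<close>
  moreover have "R = \<gamma> powr \<gamma> * real n ^ n / (real n + \<gamma>) powr (real n + \<gamma>)" if "m = n"
  proof -
    have "2 * \<gamma> / (real m + real n + 2 * \<gamma>) = \<gamma> / (real n + \<gamma>)"
        "(real m + real n) / (real m + real n + 2 * \<gamma>) = real n / (real n + \<gamma>)"
      using assms that by (auto simp: field_simps)
    then show ?thesis
      unfolding assms(6) using assms(1,3) that
      by (simp add: powr_divide powr_add powr_realpow)
  qed
  moreover have "convex (complex_of_real ` {0..R})"
    by (intro convex_linear_image linear_of_real convex_real_interval)
  ultimately show ?thesis unfolding range by (auto intro: convex_cball)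
qed

end
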